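(* Let $K_n=(V,E)$ be the complete graph with $|V|=n\ge 4$. Then the graph of the cone partition for the max-cut problem with non-negative edges, whose vertices are the cones $K^{+}_{\max}(X)$ for all cuts $X$ and whose edges join adjacent cones, has diameter exactly $2$.
   Context: Let $d=\binom{n}{2}=|E|$. For $S\subseteq V$, the cut vector $\mathbf{v}(S)\in\{0,1\}^{d}$ has coordinates indexed by edges $\{i,j\}\in E$, with $\mathbf{v}(S)_{i,j}=1$ if $|S\cap\{i,j\}|=1$ and $0$ otherwise. A cut is a nonempty proper subset $X\subset V$, where $X$ and its complement $V\setminus X$ are identified; the empty cut is excluded, so there are $2^{n-1}-1$ cuts. For a cut $X$, $K^{+}_{\max}(X)=\{\mathbf{c}\in\mathbb{R}^{d}:\ \mathbf{c}\ge\mathbf{0},\ \langle\mathbf{c},\mathbf{v}(X)\rangle\ge\langle\mathbf{c},\mathbf{v}(Y)\rangle \text{ for all cuts } Y\}$. Two cones $K^{+}_{\max}(X),K^{+}_{\max}(Y)$ with $X\ne Y$ are adjacent if $\dim\big(K^{+}_{\max}(X)\cap K^{+}_{\max}(Y)\big)=d-1$. The graph of the cone partition has one vertex per cut (the cone $K^{+}_{\max}(X)$) and an edge between two cones iff they are adjacent. *)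

theory Defs
  imports
    "HOL-Analysis.Analysis"
    "HOL-Library.Cardinality"
    "Graph_Theory.Shortest_Path"
begin

text \<open>
  The vertex set of the complete graph is the whole of a finite type \<open>'v\<close>, and its edges form
  the type \<open>'v edge\<close>, so that \<open>real ^ 'v edge\<close> is the space of edge weights. The sort \<open>card2\<close>
  (finite, at least two elements) is there only because a type must be nonempty.
\<close>

typedef (overloaded) 'v edge = "{e :: ('v::card2) set. card e = 2}"
  morphisms ends Abs_edge
  using obtain_subset_with_card_n[OF two_le_card[where 'a = 'v]] by blast

instance edge :: (card2) finite
proof
  have "inj (ends :: 'a edge \<Rightarrow> 'a set)"
    by (meson injI ends_inject)
  then show "finite (UNIV :: 'a edge set)"
    by (rule finite_imageD[rotated]) simp
qed

lemma card_edge: "CARD('v::card2 edge) = CARD('v) choose 2"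
proof -
  have "bij_betw ends (UNIV :: 'v edge set) {e :: 'v set. card e = 2}"
    using type_definition.Rep_range[OF type_definition_edge] ends_inject
    by (auto simp: bij_betw_def inj_on_def)
  then show ?thesis
    using n_subsets[of "UNIV :: 'v set" 2] by (simp add: bij_betw_same_card)
qed

definition cut_vector :: "('v::card2) set \<Rightarrow> real ^ 'v edge"
  where "cut_vector S = (\<chi> e. if card (S \<inter> ends e) = 1 then 1 else 0)"

lemma cut_vector_Compl: "cut_vector (- S) = cut_vector S"
proof -
  have "card (- S \<inter> ends e) = 1 \<longleftrightarrow> card (S \<inter> ends e) = 1" for e :: "'a edge"
  proof -
    have "card (ends e) = card (S \<inter> ends e) + card (- S \<inter> ends e)"
      by (subst card_Un_disjoint[symmetric]) (auto intro: arg_cong[of _ _ card])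
    moreover have "card (ends e) = 2"
      using ends[of e] by simp
    ultimately show ?thesis by linarith
  qed
  then show ?thesis by (simp add: cut_vector_def)
qed

definition proper_part :: "'v set \<Rightarrow> bool"
  where "proper_part X \<longleftrightarrow> X \<noteq> {} \<and> X \<noteq> UNIV"

text \<open>A cut is the unordered pair consisting of a proper part and its complement.\<close>

definition cut_of :: "'v set \<Rightarrow> 'v set set"
  where "cut_of X = {X, - X}"

definition cuts :: "'v set set set"
  where "cuts = cut_of ` {X. proper_part X}"

lemma cut_of_eq_iff: "cut_of X = cut_of Y \<longleftrightarrow> Y = X \<or> Y = - X"
  by (auto simp: cut_of_def doubleton_eq_iff)

definition max_cone :: "('v::card2) set \<Rightarrow> (real ^ 'v edge) set"
  where "max_cone X =
    {c. (\<forall>e. 0 \<le> c $ e) \<and>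
        (\<forall>Y. proper_part Y \<longrightarrow> c \<bullet> cut_vector Y \<le> c \<bullet> cut_vector X)}"

lemma max_cone_Compl: "max_cone (- X) = max_cone X"
  by (simp add: max_cone_def cut_vector_Compl)

definition adjacent_cones :: "('v::card2) set \<Rightarrow> 'v set \<Rightarrow> bool"
  where "adjacent_cones X Y \<longleftrightarrow>
    cut_of X \<noteq> cut_of Y \<and>
    aff_dim (max_cone X \<inter> max_cone Y) = int (CARD('v) choose 2) - 1"

text \<open>
  The vertex \<open>cut_of X\<close> stands for the cone \<open>max_cone X\<close>, which by \<open>max_cone_Compl\<close> depends only
  on the cut. An undirected edge is a pair of opposite arcs.
\<close>

definition cone_graph ::
  "(('v::card2) set set, 'v set set \<times> 'v set set) pre_digraph"
  where "cone_graph =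
    \<lparr>verts = cuts,
     arcs = {(cut_of X, cut_of Y) | X Y. proper_part X \<and> proper_part Y \<and> adjacent_cones X Y},
     tail = fst,
     head = snd\<rparr>"

lemma graph_cone_graph: "graph (cone_graph :: (('v::card2) set set, _) pre_digraph)"
proof
  let ?G = "cone_graph :: ('v set set, _) pre_digraph"
  show "tail ?G e \<in> verts ?G" "head ?G e \<in> verts ?G" "tail ?G e \<noteq> head ?G e"
    if "e \<in> arcs ?G" for e
    using that by (auto simp: cone_graph_def cuts_def adjacent_cones_def)
  show "finite (verts ?G)" "finite (arcs ?G)"
    by simp_all
  show "e1 = e2" if "arc_to_ends ?G e1 = arc_to_ends ?G e2" for e1 e2
    using that by (simp add: arc_to_ends_def cone_graph_def prod_eq_iff)
  have "adjacent_cones X Y \<longleftrightarrow> adjacent_cones Y X" for X Y :: "'v set"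
    by (auto simp: adjacent_cones_def Int_commute)
  then show "symmetric ?G"
    unfolding symmetric_def arcs_ends_conv sym_def by (fastforce simp: cone_graph_def)
qed

text \<open>
  Distance is the least number of arcs on a walk, infinite if there is none. The constant
  \<open>wf_digraph.\<mu>\<close> has the expected meaning only on well-formed digraphs.
\<close>

definition graph_diameter :: "('a, 'b) pre_digraph \<Rightarrow> ereal"
  where "graph_diameter G = (SUP u\<in>verts G. SUP v\<in>verts G. wf_digraph.\<mu> G (\<lambda>_. 1) u v)"

end

theory Submission
  imports Defs
begin

text \<open>
  Write \<open>\<delta>(X)\<close> for the edge set of a cut. If \<open>\<delta>(X)\<close> and \<open>\<delta>(Y)\<close> are the only cuts containing
  \<open>\<delta>(X) \<inter> \<delta>(Y)\<close>, then a very large weight on that intersection makes \<open>X\<close> and \<open>Y\<close> the only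
  maximum cuts, and the cones of \<open>X\<close> and \<open>Y\<close> share a facet. This applies to \<open>{b, c}\<close> and \<open>X\<close>
  whenever \<open>c \<in> X\<close>, \<open>b \<notin> X\<close> and \<open>X \<noteq> - {b}\<close>. Given two distinct cuts, at least three of
  the four cells they define are nonempty; after replacing sides by complements there are
  \<open>b \<in> X - Y\<close>, \<open>c \<in> Y - X\<close> and a vertex outside both, so \<open>{b, c}\<close> is a common neighbour.
  Conversely \<open>{b}\<close> and \<open>{c}\<close> are not adjacent: comparing them with \<open>{a, b}\<close> and \<open>{a, c}\<close> shows that
  the weight of every edge avoiding both \<open>b\<close> and \<open>c\<close> vanishes on the common face.
\<close>

section \<open>Cuts as edge sets, and balanced weights\<close>

definition cut_edges :: "('v::card2) set \<Rightarrow> 'v edge set"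
  where "cut_edges S = {e. card (S \<inter> ends e) = 1}"

lemma cut_vector_nth: "cut_vector S $ e = (if e \<in> cut_edges S then 1 else 0)"
  by (simp add: cut_vector_def cut_edges_def)

lemma inner_cut_vector: "c \<bullet> cut_vector S = sum (($) c) (cut_edges S)"
proof -
  have "c \<bullet> cut_vector S = (\<Sum>e\<in>UNIV. if e \<in> cut_edges S then c $ e else 0)"
    unfolding inner_vec_def by (rule sum.cong) (auto simp: cut_vector_nth)
  also have "\<dots> = sum (($) c) (cut_edges S)"
    by (simp add: sum.If_cases)
  finally show ?thesis .
qed

lemma edge_obtain_ends:
  obtains x y where "ends e = {x, y}" "x \<noteq> y"
proof -
  have "card (ends e) = 2" using ends[of e] by simp
  then show thesis using that unfolding card_2_iff by blast
qed

lemma mem_cut_edges: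
  assumes "ends e = {x, y}" "x \<noteq> y"
  shows "e \<in> cut_edges S \<longleftrightarrow> (x \<in> S) \<noteq> (y \<in> S)"
proof -
  have "S \<inter> ends e = (if x \<in> S then {x} else {}) \<union> (if y \<in> S then {y} else {})"
    using assms by auto
  then show ?thesis
    using assms by (simp add: cut_edges_def)
qed

lemma edge_with_ends:
  fixes x y :: "'v::card2"
  assumes "x \<noteq> y"
  obtains e where "ends e = {x, y}"
proof -
  have "ends (Abs_edge {x, y}) = {x, y}"
    using assms by (intro Abs_edge_inverse) simp
  then show thesis by (rule that)
qed

lemma cut_edges_Compl: "cut_edges (- S) = cut_edges S"
proof (rule set_eqI)
  fix e :: "'a edge"
  obtain x y where "ends e = {x, y}" "x \<noteq> y" by (rule edge_obtain_ends)
  then show "e \<in> cut_edges (- S) \<longleftrightarrow> e \<in> cut_edges S"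
    by (auto simp: mem_cut_edges)
qed

text \<open>Both cuts contain the intersection, so a tie only requires the two differences to have
  the same total weight. The non-inclusions make both differences nonempty, which keeps the
  balancing weights positive.\<close>

lemma exists_separating_weights:
  fixes X Y :: "('v::card2) set"
  assumes XY: "\<not> cut_edges X \<subseteq> cut_edges Y" and YX: "\<not> cut_edges Y \<subseteq> cut_edges X"
  obtains c :: "real ^ 'v edge" where
    "\<And>e. 0 < c $ e"
    "c \<bullet> cut_vector X = c \<bullet> cut_vector Y"
    "\<And>Z. \<not> cut_edges X \<inter> cut_edges Y \<subseteq> cut_edges Z \<Longrightarrow> c \<bullet> cut_vector Z < c \<bullet> cut_vector X"
proof -
  let ?I = "cut_edges X \<inter> cut_edges Y"
  let ?A = "cut_edges X - cut_edges Y"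
  let ?B = "cut_edges Y - cut_edges X"
  \<comment> \<open>Edges of \<open>?A\<close> weigh \<open>card ?B\<close> and edges of
    \<open>?B\<close> weigh \<open>card ?A\<close>, so each difference totals
    \<open>card ?A * card ?B\<close>.\<close>
  define w :: "'v edge \<Rightarrow> real" where
    "w e = (if e \<in> ?A then card ?B else if e \<in> ?B then card ?A else 1)" for e
  \<comment> \<open>\<open>M\<close> exceeds the weight of any set of edges disjoint from
    \<open>?I\<close>.\<close>
  define M where "M = 1 + sum w UNIV"
  define c :: "real ^ 'v edge" where "c = (\<chi> e. if e \<in> ?I then M else w e)"
  have w: "0 < w e" for e
    using XY YX by (auto simp: w_def card_gt_0_iff)
  have "0 < M"
    unfolding M_def using w by (simp add: add_pos_nonneg sum_nonneg less_imp_le)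
  then have pos: "0 < c $ e" for e
    using w by (simp add: c_def)
  have A: "sum (($) c) ?A = card ?A * card ?B"
  proof -
    have "sum (($) c) ?A = (\<Sum>e\<in>?A. real (card ?B))"
      by (rule sum.cong) (auto simp: c_def w_def)
    then show ?thesis by simp
  qed
  have B: "sum (($) c) ?B = card ?A * card ?B"
  proof -
    have "sum (($) c) ?B = (\<Sum>e\<in>?B. real (card ?A))"
      by (rule sum.cong) (auto simp: c_def w_def)
    then show ?thesis by simp
  qed
  have eq: "c \<bullet> cut_vector X = c \<bullet> cut_vector Y"
    using A B sum.Int_Diff[of "cut_edges X" "($) c" "cut_edges Y"]
      sum.Int_Diff[of "cut_edges Y" "($) c" "cut_edges X"]
    by (simp add: inner_cut_vector Int_commute)
  \<comment> \<open>Out of the total weight, \<open>Z\<close> misses an edge \<open>f\<close> of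
    weight \<open>M\<close>, whereas the edges missed by \<open>X\<close> together weigh less than
    \<open>M\<close>.\<close>
  have less: "c \<bullet> cut_vector Z < c \<bullet> cut_vector X" if Z: "\<not> ?I \<subseteq> cut_edges Z" for Z
  proof -
    obtain f where f: "f \<in> ?I" "f \<notin> cut_edges Z" using Z by blast
    have "sum (($) c) (- cut_edges X) = sum w (- cut_edges X)"
      by (rule sum.cong) (auto simp: c_def)
    also have "\<dots> \<le> sum w UNIV"
      using w by (intro sum_mono2) (auto intro: less_imp_le)
    finally have out: "sum (($) c) (- cut_edges X) < M" by (simp add: M_def)
    have "sum (($) c) (cut_edges Z) \<le> sum (($) c) (UNIV - {f})"
      using f pos by (intro sum_mono2) (auto intro: less_imp_le)
    also have "\<dots> = sum (($) c) UNIV - M"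
      using f by (simp add: sum_diff1 c_def)
    also have "sum (($) c) UNIV = sum (($) c) (cut_edges X) + sum (($) c) (- cut_edges X)"
      by (subst sum.union_disjoint[symmetric]) auto
    finally show ?thesis using out by (simp add: inner_cut_vector)
  qed
  show thesis using that[OF pos eq less] .
qed

section \<open>Dimension of the common face of two cones\<close>

lemma max_cone_Int_subset_hyperplane:
  assumes "proper_part X" "proper_part Y"
  shows "max_cone X \<inter> max_cone Y \<subseteq> {c. (cut_vector X - cut_vector Y) \<bullet> c = 0}"
proof
  fix c assume c: "c \<in> max_cone X \<inter> max_cone Y"
  have "c \<bullet> cut_vector X = c \<bullet> cut_vector Y"
    using c assms by (intro order_antisym) (simp_all add: max_cone_def)
  then show "c \<in> {c. (cut_vector X - cut_vector Y) \<bullet> c = 0}"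
    by (simp add: inner_diff_left inner_diff_right inner_commute)
qed

lemma aff_dim_edge_hyperplane:
  fixes a :: "real ^ 'v::card2 edge"
  assumes "a \<noteq> 0"
  shows "aff_dim {c. a \<bullet> c = r} = int (CARD('v) choose 2) - 1"
proof -
  have "DIM(real ^ 'v edge) = CARD('v) choose 2"
    by (simp add: card_edge)
  moreover have "1 \<le> DIM(real ^ 'v edge)"
    using DIM_positive[where 'a = "real ^ 'v edge"] by linarith
  ultimately show ?thesis
    unfolding aff_dim_hyperplane[OF assms] by (simp only: of_nat_diff of_nat_1)
qed

text \<open>At the separating weights every competing cut is strictly worse, and remains so nearby.
  A neighbourhood within the hyperplane where \<open>X\<close> and \<open>Y\<close> tie therefore
  lies in both cones and gives their common face the dimension of the hyperplane.\<close>

lemma adjacent_cones_if_intersection_determines: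
  fixes X Y :: "('v::card2) set"
  assumes proper: "proper_part X" "proper_part Y"
    and XY: "\<not> cut_edges X \<subseteq> cut_edges Y" and YX: "\<not> cut_edges Y \<subseteq> cut_edges X"
    and det: "\<And>Z. proper_part Z \<Longrightarrow> cut_edges X \<inter> cut_edges Y \<subseteq> cut_edges Z \<Longrightarrow>
      cut_of Z = cut_of X \<or> cut_of Z = cut_of Y"
  shows "adjacent_cones X Y"
proof -
  obtain c :: "real ^ 'v edge" where c: "\<And>e. 0 < c $ e"
      "c \<bullet> cut_vector X = c \<bullet> cut_vector Y"
      "\<And>Z. \<not> cut_edges X \<inter> cut_edges Y \<subseteq> cut_edges Z \<Longrightarrow> c \<bullet> cut_vector Z < c \<bullet> cut_vector X"
    using exists_separating_weights[OF XY YX] by metis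
  define H where "H = {c. (cut_vector X - cut_vector Y) \<bullet> c = 0}"
  define N where "N = {Z. \<not> cut_edges X \<inter> cut_edges Y \<subseteq> cut_edges Z}"
  \<comment> \<open>Finitely many strict inequalities, all satisfied by \<open>c\<close>, so
    \<open>T\<close> is an open neighbourhood of \<open>c\<close>.\<close>
  define T :: "(real ^ 'v edge) set" where
    "T = (\<Inter>e. {c. 0 < c $ e}) \<inter> (\<Inter>Z\<in>N. {c. c \<bullet> cut_vector Z < c \<bullet> cut_vector X})"
  have "cut_vector X \<noteq> cut_vector Y"
    using XY by (auto simp: vec_eq_iff cut_vector_nth split: if_splits)
  then have dimH: "aff_dim H = int (CARD('v) choose 2) - 1"
    unfolding H_def by (intro aff_dim_edge_hyperplane) simp
  have "open T"
    unfolding T_def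
    by (intro open_Int open_INT ballI open_Collect_less continuous_intros) simp_all
  moreover have "c \<in> H \<inter> T"
    using c by (simp add: H_def T_def N_def inner_diff_left inner_diff_right inner_commute)
  \<comment> \<open>A convex set keeps its dimension when intersected with an open set that meets
    it.\<close>
  ultimately have "aff_dim (H \<inter> T) = aff_dim H"
    by (intro aff_dim_convex_Int_open) (auto simp: H_def convex_hyperplane)
  moreover have "H \<inter> T \<subseteq> max_cone X \<inter> max_cone Y"
  proof
    fix w assume w: "w \<in> H \<inter> T"
    have eq: "w \<bullet> cut_vector X = w \<bullet> cut_vector Y"
      using w by (simp add: H_def inner_diff_left inner_diff_right inner_commute)
    have "w \<bullet> cut_vector Z \<le> w \<bullet> cut_vector X" if "proper_part Z" for Z
    proof (cases "Z \<in> N")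
      case True
      then show ?thesis using w by (auto simp: T_def intro: less_imp_le)
    next
      case False
      then have "cut_of Z = cut_of X \<or> cut_of Z = cut_of Y"
        using det that by (simp add: N_def)
      then have "cut_vector Z = cut_vector X \<or> cut_vector Z = cut_vector Y"
        using cut_vector_Compl by (metis cut_of_eq_iff)
      then show ?thesis using eq by auto
    qed
    then show "w \<in> max_cone X \<inter> max_cone Y"
      using w eq by (auto simp: max_cone_def T_def intro: less_imp_le)
  qed
  ultimately have "aff_dim H \<le> aff_dim (max_cone X \<inter> max_cone Y)"
    using aff_dim_subset by metis
  moreover have "aff_dim (max_cone X \<inter> max_cone Y) \<le> aff_dim H"
    unfolding H_def by (intro aff_dim_subset max_cone_Int_subset_hyperplane proper)
  moreover have "cut_of X \<noteq> cut_of Y"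
    using XY by (auto simp: cut_of_eq_iff cut_edges_Compl)
  ultimately show ?thesis
    using dimH by (simp add: adjacent_cones_def)
qed

text \<open>The common edges of the two cuts form two stars: from \<open>b\<close> to
  \<open>X - {c}\<close>, and from \<open>c\<close> to the vertices outside \<open>X\<close> other
  than \<open>b\<close>. The vertex \<open>d\<close> expresses \<open>X \<noteq> - {b}\<close>; the
  edges \<open>{b, d}\<close> and \<open>{b, c}\<close> refute the two inclusions.\<close>

lemma adjacent_cones_pair:
  fixes X :: "('v::card2) set"
  assumes "c \<in> X" "b \<notin> X" "d \<notin> X" "d \<noteq> b"
  shows "adjacent_cones {b, c} X"
proof (rule adjacent_cones_if_intersection_determines)
  show "proper_part {b, c}" "proper_part X"
    using assms by (auto simp: proper_part_def)
  obtain e where "ends e = {b, d}" using edge_with_ends assms by metis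
  then show "\<not> cut_edges {b, c} \<subseteq> cut_edges X"
    using assms mem_cut_edges[of e b d] by blast
  obtain e where "ends e = {b, c}" using edge_with_ends assms by metis
  then show "\<not> cut_edges X \<subseteq> cut_edges {b, c}"
    using assms mem_cut_edges[of e b c] by blast
next
  fix Z :: "'v set"
  assume Z: "cut_edges {b, c} \<inter> cut_edges X \<subseteq> cut_edges Z"
  have sep: "(x \<in> Z) \<noteq> (y \<in> Z)"
    if "x \<in> {b, c}" "y \<notin> {b, c}" "(x \<in> X) \<noteq> (y \<in> X)" for x y
  proof -
    have "x \<noteq> y" using that by blast
    then obtain e where "ends e = {x, y}" using edge_with_ends by metis
    then show ?thesis using Z that \<open>x \<noteq> y\<close> mem_cut_edges[of e x y] by blast
  qed
  have "x \<in> Z \<longleftrightarrow> b \<notin> Z" if "x \<in> X" "x \<noteq> c" for x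
    using sep[of b x] that assms by auto
  moreover have "x \<in> Z \<longleftrightarrow> c \<notin> Z" if "x \<notin> X" "x \<noteq> b" for x
    using sep[of c x] that assms by auto
  \<comment> \<open>By the two stars, \<open>Z\<close> is fixed by its values at \<open>b\<close>
    and \<open>c\<close>: equal values give \<open>{b, c}\<close> or its complement, different ones
    give \<open>X\<close> or its complement.\<close>
  ultimately have "Z = {b, c} \<or> Z = - {b, c} \<or> Z = X \<or> Z = - X"
    using assms(1,2) by (cases "b \<in> Z"; cases "c \<in> Z") blast+
  then show "cut_of Z = cut_of {b, c} \<or> cut_of Z = cut_of X"
    by (auto simp: cut_of_def)
qed

text \<open>The common face lies in two different hyperplanes: \<open>?H\<close>, where the two cuts
  tie, and \<open>?F\<close>, where the weight of \<open>f\<close> vanishes. Hence its dimension is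
  smaller than that of \<open>?H\<close>. The fourth vertex \<open>a'\<close> provides an edge
  \<open>f\<close> at \<open>a\<close> avoiding \<open>b\<close> and \<open>c\<close>.\<close>

lemma not_adjacent_cones_singletons:
  fixes a a' b c :: "'v::card2"
  assumes "distinct [a, a', b, c]"
  shows "\<not> adjacent_cones {b} {c}"
proof
  assume adj: "adjacent_cones {b} {c}"
  obtain f where f: "ends f = {a, a'}" using edge_with_ends assms by (metis distinct_length_2_or_more)
  let ?I = "max_cone {b} \<inter> max_cone {c}"
  let ?H = "{w. (cut_vector {b} - cut_vector {c}) \<bullet> w = 0}"
  let ?F = "{w :: real ^ 'v edge. axis f 1 \<bullet> w = 0}"
  have proper: "proper_part {b}" "proper_part {c}" "proper_part {a, b}" "proper_part {a, c}"
    using assms by (auto simp: proper_part_def)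
  have fbc: "f \<notin> cut_edges {b}" "f \<notin> cut_edges {c}"
    using assms by (auto simp: mem_cut_edges[OF f])
  have "?I \<subseteq> ?F"
  proof
    fix w assume w: "w \<in> ?I"
    \<comment> \<open>An edge from \<open>a\<close> to a vertex other than \<open>b\<close> and
      \<open>c\<close> lies in both cuts on the right and in neither star on the left; this is the
      surplus 2 at \<open>f\<close>.\<close>
    have le: "(cut_vector {b} + cut_vector {c} + 2 *\<^sub>R axis f 1) $ e
        \<le> (cut_vector {a, b} + cut_vector {a, c}) $ e" for e
    proof -
      obtain x y where e: "ends e = {x, y}" "x \<noteq> y" by (rule edge_obtain_ends)
      note mem = mem_cut_edges[OF e]
      have "e \<in> cut_edges {b} \<or> e \<in> cut_edges {c} \<Longrightarrow> e \<in> cut_edges {a, b} \<or> e \<in> cut_edges {a, c}"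
        "e \<in> cut_edges {b} \<Longrightarrow> e \<in> cut_edges {c} \<Longrightarrow> e \<in> cut_edges {a, b} \<and> e \<in> cut_edges {a, c}"
        unfolding mem insert_iff empty_iff using assms by auto
      moreover have "f \<in> cut_edges {a, b}" "f \<in> cut_edges {a, c}"
        using assms by (auto simp: mem_cut_edges[OF f])
      ultimately show ?thesis
        using fbc by (cases "e = f") (auto simp: cut_vector_nth axis_def)
    qed
    have "w \<bullet> (cut_vector {b} + cut_vector {c} + 2 *\<^sub>R axis f 1)
        \<le> w \<bullet> (cut_vector {a, b} + cut_vector {a, c})"
      unfolding inner_vec_def inner_real_def
      by (rule sum_mono, rule mult_left_mono[OF le]) (use w in \<open>simp add: max_cone_def\<close>)
    \<comment> \<open>Maximality of \<open>{b}\<close> and \<open>{c}\<close> bounds the right-hand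
      side by the two stars alone, which leaves no room for a positive weight on
      \<open>f\<close>.\<close>
    moreover have "w \<bullet> cut_vector {a, b} \<le> w \<bullet> cut_vector {b}"
        "w \<bullet> cut_vector {a, c} \<le> w \<bullet> cut_vector {c}"
      using w proper by (auto simp: max_cone_def)
    ultimately have "w $ f \<le> 0"
      by (simp add: inner_add_right inner_axis)
    moreover have "0 \<le> w $ f" using w by (simp add: max_cone_def)
    ultimately show "w \<in> ?F" by (simp add: inner_axis inner_commute)
  qed
  have "?I \<subseteq> ?H"
    by (rule max_cone_Int_subset_hyperplane) (use proper in auto)
  \<comment> \<open>The unit vector at \<open>f\<close> shows that passing from \<open>?H\<close> to
    its intersection with \<open>?F\<close> is a strict decrease.\<close>
  have "axis f 1 \<in> ?H" "axis f 1 \<notin> ?F"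
    using fbc by (auto simp: inner_axis cut_vector_nth)
  have "affine hull ?I \<subseteq> ?F" "affine hull ?I \<subseteq> ?H"
    by (rule hull_minimal, fact, rule affine_hyperplane)+
  then have "affine hull ?I \<subset> affine hull ?H"
    using \<open>axis f 1 \<in> ?H\<close> \<open>axis f 1 \<notin> ?F\<close> hull_same[of affine ?H] affine_hyperplane by blast
  then have "aff_dim ?I < aff_dim ?H" by (rule aff_dim_psubset)
  moreover have "aff_dim ?H = int (CARD('v) choose 2) - 1"
  proof -
    obtain g where g: "ends g = {a, b}" using edge_with_ends assms by (metis distinct_length_2_or_more)
    have "g \<in> cut_edges {b}" "g \<notin> cut_edges {c}"
      using assms by (auto simp: mem_cut_edges[OF g])
    then have "cut_vector {b} \<noteq> cut_vector {c}"
      by (metis cut_vector_nth zero_neq_one)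
    then show ?thesis
      by (intro aff_dim_edge_hyperplane) simp
  qed
  ultimately show False using adj by (simp add: adjacent_cones_def)
qed

section \<open>Adjacency as a relation on cuts, and common neighbours\<close>

lemma adjacent_cones_sym: "adjacent_cones X Y \<longleftrightarrow> adjacent_cones Y X"
  by (auto simp: adjacent_cones_def Int_commute)

text \<open>Adjacency is defined on sides, while the vertices of the graph are cuts; this allows a
  side to be exchanged for its complement.\<close>

lemma adjacent_cones_cut_of_cong:
  assumes "cut_of X = cut_of X'" "cut_of Y = cut_of Y'"
  shows "adjacent_cones X Y \<longleftrightarrow> adjacent_cones X' Y'"
proof -
  have "max_cone X = max_cone X'" "max_cone Y = max_cone Y'"
    using assms by (metis cut_of_eq_iff max_cone_Compl)+
  then show ?thesis using assms by (simp add: adjacent_cones_def)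
qed

lemma common_neighbour:
  fixes X Y :: "('v::card2) set"
  assumes "proper_part X" "proper_part Y" "cut_of X \<noteq> cut_of Y"
  obtains W where "proper_part W" "adjacent_cones X W" "adjacent_cones W Y"
proof -
  obtain X' Y' b c d where XY: "cut_of X = cut_of X'" "cut_of Y = cut_of Y'"
    and bcd: "b \<in> X'" "b \<notin> Y'" "c \<in> Y'" "c \<notin> X'" "d \<notin> X'" "d \<notin> Y'"
  proof -
    \<comment> \<open>At most one of the four cells is empty: two empty cells would make a side
      improper or the cuts equal. Complementing the sides moves any cell to the position
      \<open>X' \<inter> Y'\<close>, the only one left unconstrained.\<close>
    have "\<exists>X'\<in>{X, - X}. \<exists>Y'\<in>{Y, - Y}. X' - Y' \<noteq> {} \<and> Y' - X' \<noteq> {} \<and> - X' \<inter> - Y' \<noteq> {}"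
      using assms unfolding proper_part_def cut_of_eq_iff by simp blast
    then obtain X' Y' where "X' \<in> {X, - X}" "Y' \<in> {Y, - Y}"
      and cells: "X' - Y' \<noteq> {}" "Y' - X' \<noteq> {}" "- X' \<inter> - Y' \<noteq> {}"
      by blast
    then have "cut_of X = cut_of X'" "cut_of Y = cut_of Y'"
      by (auto simp: cut_of_eq_iff)
    then show thesis
      using that cells by blast
  qed
  \<comment> \<open>The same \<open>d\<close> serves both times, with the roles of \<open>b\<close>
    and \<open>c\<close> exchanged.\<close>
  have "adjacent_cones {b, c} Y'" "adjacent_cones {c, b} X'"
    using bcd by (auto intro: adjacent_cones_pair)
  then have "adjacent_cones X {b, c}" "adjacent_cones {b, c} Y"
    using XY adjacent_cones_cut_of_cong adjacent_cones_sym by (metis insert_commute)+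
  moreover have "proper_part {b, c}"
    using bcd by (auto simp: proper_part_def)
  ultimately show thesis using that by blast
qed

text \<open>An arc may come from other representatives of the two cuts; these differ from
  \<open>X\<close> and \<open>Y\<close> only by complements.\<close>

lemma arc_cone_graph_iff:
  fixes X Y :: "('v::card2) set"
  assumes "proper_part X" "proper_part Y"
  shows "(cut_of X, cut_of Y) \<in> arcs cone_graph \<longleftrightarrow> adjacent_cones X Y"
proof
  assume "(cut_of X, cut_of Y) \<in> arcs cone_graph"
  then obtain X' Y' where "cut_of X = cut_of X'" "cut_of Y = cut_of Y'" "adjacent_cones X' Y'"
    by (auto simp: cone_graph_def)
  then show "adjacent_cones X Y"
    using adjacent_cones_cut_of_cong by blast
qed (use assms in \<open>auto simp: cone_graph_def\<close>)

section \<open>Walks and the diameter of the cone graph\<close>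

theorem theorem5:
  fixes n :: nat
  assumes "CARD('v::card2) = n"
    and "n \<ge> 4"
  shows "graph_diameter
    (cone_graph :: ('v set set, 'v set set \<times> 'v set set) pre_digraph) = 2"
proof -
  let ?G = "cone_graph :: ('v set set, 'v set set \<times> 'v set set) pre_digraph"
  interpret graph ?G by (rule graph_cone_graph)
  have G: "verts ?G = cuts" "tail ?G = fst" "head ?G = snd"
    by (simp_all add: cone_graph_def)
  have upper: "\<mu> (\<lambda>_. 1) u v \<le> 2" if uv: "u \<in> verts ?G" "v \<in> verts ?G" for u v
  proof -
    obtain X Y where XY: "proper_part X" "proper_part Y" "u = cut_of X" "v = cut_of Y"
      using uv by (auto simp: G cuts_def)
    show ?thesis
    proof (cases "u = v")
      case True
      then have "awalk u [] v" using uv by (simp add: awalk_Nil_iff)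
      from min_cost_le_walk_cost[OF this, of "\<lambda>_. 1"] show ?thesis
        by (simp add: order_trans[of _ 0] zero_ereal_def[symmetric])
    next
      case False
      then obtain W where W: "proper_part W" "adjacent_cones X W" "adjacent_cones W Y"
        using XY common_neighbour by metis
      have "awalk u [(u, cut_of W), (cut_of W, v)] v"
        using uv W XY by (simp add: awalk_def G arc_cone_graph_iff)
      from min_cost_le_walk_cost[OF this, of "\<lambda>_. 1"] show ?thesis
        by simp
    qed
  qed
  \<comment> \<open>The bound \<open>n \<ge> 4\<close> supplies the four vertices that make two
    singleton cuts non-adjacent.\<close>
  obtain S where "S \<subseteq> (UNIV :: 'v set)" "card S = 4"
    using obtain_subset_with_card_n[of 4 "UNIV :: 'v set"] assms by auto
  then obtain xs :: "'v list" where "distinct xs" "length xs = 4"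
    by (metis card.infinite distinct_card finite_distinct_list zero_neq_numeral)
  then obtain a a' b c :: 'v where abcd: "distinct [a, a', b, c]"
    by (auto simp: length_Suc_conv numeral_eq_Suc)
  have proper: "proper_part {b}" "proper_part {c}"
    using abcd by (auto simp: proper_part_def)
  have verts: "cut_of {b} \<in> verts ?G" "cut_of {c} \<in> verts ?G"
    using proper by (auto simp: G cuts_def)
  have ne: "cut_of {b} \<noteq> cut_of {c}"
    using abcd by (auto simp: cut_of_eq_iff)
  have noarc: "(cut_of {b}, cut_of {c}) \<notin> arcs ?G"
    using not_adjacent_cones_singletons[OF abcd] arc_cone_graph_iff[OF proper] by simp
  \<comment> \<open>The empty walk would need equal endpoints, and a one-arc walk would need the
    missing arc, so every walk has at least two arcs.\<close>
  have lower: "2 \<le> \<mu> (\<lambda>_. 1) (cut_of {b}) (cut_of {c})"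
    unfolding \<mu>_def
  proof (rule INF_greatest)
    fix p assume "p \<in> {p. awalk (cut_of {b}) p (cut_of {c})}"
    then have p: "awalk (cut_of {b}) p (cut_of {c})" by simp
    have "p \<noteq> []" using p ne by (auto simp: awalk_def)
    moreover have "p \<noteq> [e]" for e
      using p noarc by (cases e) (auto simp: awalk_def G)
    \<comment> \<open>The case rule of \<open>remdups_adj\<close> splits lists into empty, singleton
      and longer ones.\<close>
    ultimately have "2 \<le> length p"
      by (cases p rule: remdups_adj.cases) auto
    then show "2 \<le> ereal (awalk_cost (\<lambda>_. 1) p)"
      by (simp add: awalk_cost_def sum_list_triv)
  qed
  show ?thesis
    unfolding graph_diameter_def
  proof (rule antisym)
    show "(SUP u\<in>verts ?G. SUP v\<in>verts ?G. \<mu> (\<lambda>_. 1) u v) \<le> 2"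
      using upper by (intro SUP_least)
    show "2 \<le> (SUP u\<in>verts ?G. SUP v\<in>verts ?G. \<mu> (\<lambda>_. 1) u v)"
      by (intro SUP_upper2[OF verts(1)] SUP_upper2[OF verts(2)] lower)
  qed
qed

end
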